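(* Let $f=(f_1,f_2)\in\mathbb{R}[x_1,x_2]^2$ satisfy the genericity conditions listed in the context, let $S=\{r\in\mathbb{R}^2: f(r)\ne0\text{ and } r\text{ is a singular point of }C_r\}$, and let $$\gamma=\begin{bmatrix}\det[\,\partial_{x_1}f\ \ f\,]\\ \det[\,\partial_{x_2}f\ \ f\,]\end{bmatrix},\qquad P=\begin{bmatrix}0&-1\\1&0\end{bmatrix}.$$ If $r\in S$, then the tangent cone $T_r\subset\mathbb{C}^2$ of $C_r$ at $r$ is equal to the union of the eigenspaces (in $\mathbb{C}^2$) of the matrix $(\partial_x(P\gamma))(r)$, where $\partial_x$ denotes the Jacobian matrix with respect to $x=(x_1,x_2)$.
   Context: For polynomials, $V_{\mathbb{R}}(\cdot)$ and $V_{\mathbb{C}}(\cdot)$ denote the common zero sets in $\mathbb{R}^2$ and $\mathbb{C}^2$. Let $f=(f_1,f_2)\in\mathbb{R}[x_1,x_2]^2$, regarded as a column vector, with $d_j=\deg f_j>0$, $d_1\ge d_2$, $d_1\ge 2$. Newton homotopy curves: for $r\in\mathbb{R}^2\setminus V_{\mathbb{R}}(f)$, $C_r=\{x\in\mathbb{R}^2:\exists t\in\mathbb{R},\ f(x)=t f(r)\}$. For $r\in\mathbb{C}^2\setminus V_{\mathbb{C}}(f)$, $C_r^{\mathbb{C}}=\{x\in\mathbb{C}^2:\exists t\in\mathbb{C},\ f(x)=t f(r)\}$. These are the real, respectively complex, zero sets of the polynomial $h(x,r)=\det[\,f(x)\ \ f(r)\,]=f_1(x)f_2(r)-f_2(x)f_1(r)$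 in $x$. A point of the curve is singular if the gradient of $h(x,r)$ with respect to $x$ vanishes there. The tangent cone of $C_r$ at a point $r$ is the zero set in $\mathbb{C}^2$ of the lowest-degree nonzero homogeneous part, in $v$, of the polynomial $h(r+v,r)$. "Smooth at infinity" means that the closure of the complex curve in the complex projective plane is nonsingular at all its points on the line at infinity. Genericity conditions on $f$: (1) each $V_{\mathbb{C}}(f_j)$ is a smooth curve of degree $d_j$; (2) $f_j^*=0$ has $d_j$ nonsingular solutions in complex projective space $\mathbb{P}^1$, where $f_j^*$ is the homogeneous part of $f_j$ of highest degree $d_j$; (3) $V_{\mathbb{C}}(f_1,f_2)$ is a complete intersection with $d_1d_2$ nonsingular solutions in $\mathbb{C}^2$; (4) for every $r\in\mathbb{C}^2\setminus V_{\mathbb{C}}(f)$: (a) $C_r^{\mathbb{C}}$ is a curve of degree $d_1$ whenever $f_2(r)\ne0$; (b) $C_r^{\mathbb{C}}$ is smooth at infinity except possibly when $f_2(r)=0$ and $d_1>d_2$; (c) $C_r^{\mathbb{C}}$ has at most one singularity, and that singularity, if it exists, is an ordinary double point (nondegenerate Hessian). *)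

theory Defs
  imports "HOL-Analysis.Cartesian_Euclidean_Space" "HOL-Analysis.Determinants"
    "HOL-Computational_Algebra.Polynomial" "HOL-Computational_Algebra.Squarefree"
begin

(* A bivariate polynomial p(x1,x2) is a polynomial in x2 whose coefficients are polynomials
   in x1: the coefficient of x1^i x2^j is coeff (coeff p j) i. *)
type_synonym 'a poly2 = "'a poly poly"

definition const2 :: "'a::zero \<Rightarrow> 'a poly2" where
  "const2 c = [:[:c:]:]"

definition poly2 :: "'a::comm_semiring_1 poly2 \<Rightarrow> 'a^2 \<Rightarrow> 'a" where
  "poly2 p x = poly (poly p [:x$2:]) (x$1)"

definition poly2_vec :: "('a::comm_semiring_1 poly2)^'n \<Rightarrow> 'a^2 \<Rightarrow> 'a^'n" where
  "poly2_vec g x = (\<chi> i. poly2 (g$i) x)"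

definition poly2_mat :: "('a::comm_semiring_1 poly2)^'n^'m \<Rightarrow> 'a^2 \<Rightarrow> 'a^'n^'m" where
  "poly2_mat A x = (\<chi> i. poly2_vec (A$i) x)"

definition zeros2 :: "'a::comm_semiring_1 poly2 \<Rightarrow> ('a^2) set" where
  "zeros2 p = {x. poly2 p x = 0}"

definition complexify :: "real poly2 \<Rightarrow> complex poly2" where
  "complexify p = map_poly (map_poly complex_of_real) p"

definition partial2 :: "2 \<Rightarrow> 'a::idom poly2 \<Rightarrow> 'a poly2" where
  "partial2 i p = (if i = 1 then map_poly pderiv p else pderiv p)"

definition gradient2 :: "'a::idom poly2 \<Rightarrow> ('a poly2)^2" where
  "gradient2 p = (\<chi> i. partial2 i p)"

definition jacobian2 :: "('a::idom poly2)^'n \<Rightarrow> ('a poly2)^2^'n" where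
  "jacobian2 g = (\<chi> i. gradient2 (g$i))"

definition hessian2 :: "'a::idom poly2 \<Rightarrow> ('a poly2)^2^2" where
  "hessian2 p = jacobian2 (gradient2 p)"

(* Total degree; the zero polynomial gets 0. *)
definition total_degree :: "'a::zero poly2 \<Rightarrow> nat" where
  "total_degree p = (LEAST n. \<forall>i j. coeff (coeff p j) i \<noteq> 0 \<longrightarrow> i + j \<le> n)"

definition hom_part :: "nat \<Rightarrow> 'a::comm_semiring_1 poly2 \<Rightarrow> 'a poly2" where
  "hom_part n p = (\<Sum>j\<le>n. monom (monom (coeff (coeff p j) (n - j)) (n - j)) j)"

definition top_form :: "'a::comm_semiring_1 poly2 \<Rightarrow> 'a poly2" where
  "top_form p = hom_part (total_degree p) p"

definition lowest_form :: "'a::comm_semiring_1 poly2 \<Rightarrow> 'a poly2" where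
  "lowest_form p = hom_part (LEAST n. hom_part n p \<noteq> 0) p"

(* The polynomial p(r + v) in the variables v. *)
definition translate2 :: "'a::comm_semiring_1^2 \<Rightarrow> 'a poly2 \<Rightarrow> 'a poly2" where
  "translate2 r p = pcompose (map_poly (\<lambda>c. pcompose c [:r$1, 1:]) p) [:[:r$2:], 1:]"

(* The degree of a plane curve, given as a point set, is that of a squarefree equation for it
   (unique up to a constant factor, by the Nullstellensatz). *)
definition plane_curve_of_degree :: "(complex^2) set \<Rightarrow> nat \<Rightarrow> bool" where
  "plane_curve_of_degree V d \<longleftrightarrow>
     d > 0 \<and> (\<exists>p. squarefree p \<and> total_degree p = d \<and> V = zeros2 p)"

(* The homogenization x3^d p(x1/x3, x2/x3), d the total degree of p, as a polynomial in x3 with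
   coefficients in the polynomials in x1, x2. *)
definition homogenize :: "'a::comm_semiring_1 poly2 \<Rightarrow> 'a poly2 poly" where
  "homogenize p = (\<Sum>k\<le>total_degree p. monom (hom_part (total_degree p - k) p) k)"

definition poly3 :: "'a::comm_semiring_1 poly2 poly \<Rightarrow> 'a^3 \<Rightarrow> 'a" where
  "poly3 F X = poly2 (poly F (const2 (X$3))) (vector [X$1, X$2])"

definition gradient3_at :: "'a::idom poly2 poly \<Rightarrow> 'a^3 \<Rightarrow> 'a^3" where
  "gradient3_at F X =
     vector [poly3 (map_poly (partial2 1) F) X, poly3 (map_poly (partial2 2) F) X,
             poly3 (pderiv F) X]"

(* Homogeneous coordinates of the points in the closure of V in the complex projective plane.
   The projection from complex^3 - {0} is an open map, so the preimage of a closure is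
   the closure of the preimage. *)
definition projective_closure :: "(complex^2) set \<Rightarrow> (complex^3) set" where
  "projective_closure V =
     closure {s *s vector [x$1, x$2, 1] | s x. s \<noteq> 0 \<and> x \<in> V} - {0}"

definition smooth_at_infinity :: "complex poly2 \<Rightarrow> bool" where
  "smooth_at_infinity p \<longleftrightarrow>
     (\<forall>X \<in> projective_closure (zeros2 p). X$3 = 0 \<longrightarrow> gradient3_at (homogenize p) X \<noteq> 0)"

(* The zeros in the projective line of a form in two variables; a point of the projective line
   is a line through the origin. *)
definition proj_zeros :: "complex poly2 \<Rightarrow> (complex^2) set set" where
  "proj_zeros p = {vec.span {u} | u. u \<noteq> 0 \<and> poly2 p u = 0}"

definition columns2 :: "'a^2 \<Rightarrow> 'a^2 \<Rightarrow> 'a::zero^2^2" where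
  "columns2 u v = transpose (vector [u, v])"

definition newton_curve :: "('a::comm_ring_1 poly2)^2 \<Rightarrow> 'a^2 \<Rightarrow> ('a^2) set" where
  "newton_curve f r = {x. \<exists>t. poly2_vec f x = t *s poly2_vec f r}"

(* h(x,r) = det [f(x) f(r)], as a polynomial in x. *)
definition newton_poly :: "('a::comm_ring_1 poly2)^2 \<Rightarrow> 'a^2 \<Rightarrow> 'a poly2" where
  "newton_poly f r = det (columns2 f (\<chi> i. const2 (poly2 (f$i) r)))"

definition newton_singularities :: "('a::idom poly2)^2 \<Rightarrow> 'a^2 \<Rightarrow> ('a^2) set" where
  "newton_singularities f r =
     {x \<in> newton_curve f r. poly2_vec (gradient2 (newton_poly f r)) x = 0}"

definition newton_tangent_cone :: "(real poly2)^2 \<Rightarrow> real^2 \<Rightarrow> (complex^2) set" where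
  "newton_tangent_cone f r = zeros2 (complexify (lowest_form (translate2 r (newton_poly f r))))"

definition singular_base_points :: "(real poly2)^2 \<Rightarrow> (real^2) set" where
  "singular_base_points f = {r. poly2_vec f r \<noteq> 0 \<and> r \<in> newton_singularities f r}"

definition smooth_components :: "(complex poly2)^2 \<Rightarrow> bool" where
  "smooth_components f \<longleftrightarrow>
     (\<forall>j. plane_curve_of_degree (zeros2 (f$j)) (total_degree (f$j)) \<and>
          (\<forall>x \<in> zeros2 (f$j). poly2_vec (gradient2 (f$j)) x \<noteq> 0))"

definition nonsingular_top_forms :: "(complex poly2)^2 \<Rightarrow> bool" where
  "nonsingular_top_forms f \<longleftrightarrow>
     (\<forall>j. card (proj_zeros (top_form (f$j))) = total_degree (f$j) \<and>
          (\<forall>u. u \<noteq> 0 \<and> poly2 (top_form (f$j)) u = 0 \<longrightarrow>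
               poly2_vec (gradient2 (top_form (f$j))) u \<noteq> 0))"

(* Two equations in the plane define a complete intersection iff they have finitely many
   common zeros. *)
definition nonsingular_complete_intersection :: "(complex poly2)^2 \<Rightarrow> bool" where
  "nonsingular_complete_intersection f \<longleftrightarrow>
     finite {x. poly2_vec f x = 0} \<and>
     card {x. poly2_vec f x = 0} = total_degree (f$1) * total_degree (f$2) \<and>
     (\<forall>x. poly2_vec f x = 0 \<longrightarrow> det (poly2_mat (jacobian2 f) x) \<noteq> 0)"

definition generic_newton_curves :: "(complex poly2)^2 \<Rightarrow> bool" where
  "generic_newton_curves f \<longleftrightarrow>
     (\<forall>r. poly2_vec f r \<noteq> 0 \<longrightarrow>
        (poly2 (f$2) r \<noteq> 0 \<longrightarrow>
           plane_curve_of_degree (newton_curve f r) (total_degree (f$1))) \<and>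
        (\<not> (poly2 (f$2) r = 0 \<and> total_degree (f$1) > total_degree (f$2)) \<longrightarrow>
           smooth_at_infinity (newton_poly f r)) \<and>
        (\<forall>x \<in> newton_singularities f r. \<forall>y \<in> newton_singularities f r. x = y) \<and>
        (\<forall>x \<in> newton_singularities f r. det (poly2_mat (hessian2 (newton_poly f r)) x) \<noteq> 0))"

definition generic :: "(real poly2)^2 \<Rightarrow> bool" where
  "generic f \<longleftrightarrow>
     (let fc = (\<chi> j. complexify (f$j)) in
        smooth_components fc \<and> nonsingular_top_forms fc \<and>
        nonsingular_complete_intersection fc \<and> generic_newton_curves fc)"

definition gamma :: "(real poly2)^2 \<Rightarrow> (real poly2)^2" where
  "gamma f = (\<chi> i. det (columns2 (\<chi> j. partial2 i (f$j)) f))"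

definition rot_P :: "(real poly2)^2^2" where
  "rot_P = vector [vector [0, -1], vector [1, 0]]"

definition complex_mat :: "real^'n^'m \<Rightarrow> complex^'n^'m" where
  "complex_mat A = (\<chi> i j. complex_of_real (A$i$j))"

definition eigenspace :: "'a::field^'n^'n \<Rightarrow> 'a \<Rightarrow> ('a^'n) set" where
  "eigenspace A c = {v. A *v v = c *s v}"

definition is_eigenvalue :: "'a::field^'n^'n \<Rightarrow> 'a \<Rightarrow> bool" where
  "is_eigenvalue A c \<longleftrightarrow> (\<exists>v. v \<noteq> 0 \<and> A *v v = c *s v)"

end

(* With h(x) = det [f(x) f(r)], the gradient of h at r is gamma(r), so gamma(r) = 0, and the Taylor
   expansion of h at r starts with the quadratic form of the Hessian H, which is nonzero by
   genericity. The Jacobian of gamma at r differs from H by an antisymmetric matrix whose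
   entries are, up to sign, the Jacobian determinant of f at r; this determinant vanishes
   because gamma(r) = 0 says that the nonzero row vector (f2(r), -f1(r)) annihilates the
   Jacobian matrix of f at r. Hence the matrix of the theorem is P H.
   Finally det [v, P H v] is the value of the quadratic form of H at v, so the form vanishes at v
   exactly when P H v is parallel to v. *)
theory Submission
  imports Defs
begin

section \<open>Evaluation and partial differentiation of bivariate polynomials\<close>

lemma poly2_hom [simp]:
  fixes p q :: "'a::comm_ring_1 poly2"
  shows "poly2 (p + q) x = poly2 p x + poly2 q x"
    and "poly2 (p - q) x = poly2 p x - poly2 q x"
    and "poly2 (- p) x = - poly2 p x"
    and "poly2 (p * q) x = poly2 p x * poly2 q x"
    and "poly2 (const2 c) x = c"
  by (simp_all add: poly2_def const2_def)

lemma partial2_additive [simp]: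
  fixes p q :: "'a::idom poly2"
  shows "partial2 i (p + q) = partial2 i p + partial2 i q"
    and "partial2 i (p - q) = partial2 i p - partial2 i q"
    and "partial2 i (- p) = - partial2 i p"
  by (simp_all add: partial2_def poly_eq_iff coeff_map_poly pderiv_add pderiv_diff pderiv_minus
        algebra_simps)

lemma partial2_mult:
  fixes p q :: "'a::idom poly2"
  shows "partial2 i (p * q) = partial2 i p * q + p * partial2 i q"
proof (cases "i = 1")
  case True
  have sum_pderiv: "pderiv (sum g A) = (\<Sum>k\<in>A. pderiv (g k))" for g :: "nat \<Rightarrow> 'a poly" and A
    using higher_pderiv_sum[of 1 g A] by simp
  have "map_poly pderiv (p * q) = map_poly pderiv p * q + p * map_poly pderiv q"
    by (rule poly_eqI)
      (simp add: coeff_map_poly coeff_mult sum_pderiv pderiv_mult sum.distrib, simp add: ac_simps)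
  with True show ?thesis
    by (simp add: partial2_def)
qed (simp add: partial2_def pderiv_mult algebra_simps)

lemma partial2_const_mult [simp]:
  fixes p :: "'a::idom poly2"
  shows "partial2 i (const2 c * p) = const2 c * partial2 i p"
    and "partial2 i (p * const2 c) = partial2 i p * const2 c"
proof -
  have "partial2 i (const2 c) = 0"
    by (simp add: partial2_def const2_def map_poly_pCons pderiv_pCons)
  then show "partial2 i (const2 c * p) = const2 c * partial2 i p"
    "partial2 i (p * const2 c) = partial2 i p * const2 c"
    by (simp_all add: partial2_mult)
qed

lemma partial2_commute:
  fixes p :: "'a::idom poly2"
  shows "partial2 i (partial2 j p) = partial2 j (partial2 i p)"
proof -
  have "map_poly pderiv (pderiv p) = pderiv (map_poly pderiv p)"
    by (simp add: poly_eq_iff coeff_map_poly coeff_pderiv of_nat_poly pderiv_smult algebra_simps)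
  then show ?thesis
    by (simp add: partial2_def)
qed

section \<open>Translation and the Taylor coefficients up to order two\<close>

lemma poly2_translate2:
  fixes p :: "'a::comm_ring_1 poly2"
  shows "poly2 (translate2 r p) v = poly2 p (r + v)"
proof -
  have "poly (poly (map_poly (\<lambda>c. pcompose c [:r$1, 1:]) p) [:y:]) z = poly (poly p [:y:]) (r$1 + z)"
    for y z
    by (induction p) (simp_all add: map_poly_pCons poly_pcompose)
  moreover have "poly [:[:r$2:], 1:] [:v$2:] = [:r$2 + v$2:]"
    by simp
  ultimately show ?thesis
    by (simp only: poly2_def translate2_def poly_pcompose vector_add_component)
qed

text \<open>The chain rule, with inner derivative 1. The two variables need separate arguments
  because \<open>translate2\<close> shifts x1 inside the coefficients but x2 by an outer
  composition.\<close>

lemma partial2_translate2: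
  fixes p :: "'a::idom poly2"
  shows "partial2 i (translate2 r p) = translate2 r (partial2 i p)"
proof -
  let ?s = "\<lambda>c. pcompose c [:r$1, 1:]"
  let ?l = "[:[:r$2:], 1:] :: 'a poly2"
  have s_pderiv: "pderiv (?s c) = ?s (pderiv c)" for c
    by (simp add: pderiv_pcompose pderiv_pCons)
  have s_mult_nat: "?s (of_nat n * c) = of_nat n * ?s c" for n c
    by (simp add: of_nat_poly pcompose_smult)
  show ?thesis
  proof (cases "i = 1")
    case True
    have l: "partial2 1 ?l = 0"
      by (simp add: partial2_def map_poly_pCons pderiv_pCons)
    \<comment> \<open>In Horner form the substituted \<open>?l\<close> is constant in x1, so the
      product rule leaves only the derivatives of the coefficients.\<close>
    have "partial2 1 (pcompose (map_poly ?s p) ?l) = pcompose (map_poly ?s (partial2 1 p)) ?l"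
    proof (induction p)
      case (pCons a p)
      have "partial2 1 [:b:] = [:pderiv b:]" for b :: "'a poly"
        by (simp add: partial2_def map_poly_pCons)
      moreover have "partial2 1 (pCons a p) = pCons (pderiv a) (partial2 1 p)"
        by (simp add: partial2_def map_poly_pCons)
      ultimately show ?case
        using pCons.IH
        by (simp add: map_poly_pCons pcompose_pCons partial2_mult l s_pderiv del: mult_pCons_left)
    qed (simp add: partial2_def)
    then show ?thesis
      using True by (simp add: translate2_def)
  next
    case False
    have "pderiv (map_poly ?s p) = map_poly ?s (pderiv p)"
      by (simp add: poly_eq_iff coeff_map_poly coeff_pderiv s_mult_nat del: of_nat_Suc)
    then show ?thesis
      using False by (simp add: partial2_def translate2_def pderiv_pcompose pderiv_pCons)
  qed
qed

lemma poly2_at_0: "poly2 p 0 = coeff (coeff p 0) 0"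
  by (simp add: poly2_def poly_0_coeff_0)

text \<open>The value of a derivative at r is the constant coefficient of the translated derivative,
  and differentiation commutes with translation; so each coefficient is read off by differentiating
  the translate. The factor 2 stays on the left because an integral domain need not allow division
  by 2.\<close>

lemma taylor_coeffs:
  fixes p :: "'a::idom poly2"
  shows "coeff (coeff (translate2 r p) 0) 0 = poly2 p r"
    and "coeff (coeff (translate2 r p) 0) 1 = poly2 (partial2 1 p) r"
    and "coeff (coeff (translate2 r p) 1) 0 = poly2 (partial2 2 p) r"
    and "2 * coeff (coeff (translate2 r p) 0) 2 = poly2 (partial2 1 (partial2 1 p)) r"
    and "coeff (coeff (translate2 r p) 1) 1 = poly2 (partial2 1 (partial2 2 p)) r"
    and "2 * coeff (coeff (translate2 r p) 2) 0 = poly2 (partial2 2 (partial2 2 p)) r"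
proof -
  have at_r: "poly2 q r = coeff (coeff (translate2 r q) 0) 0" for q :: "'a poly2"
    using poly2_translate2[of r q 0] by (simp add: poly2_at_0)
  show "coeff (coeff (translate2 r p) 0) 0 = poly2 p r"
    "coeff (coeff (translate2 r p) 0) 1 = poly2 (partial2 1 p) r"
    "coeff (coeff (translate2 r p) 1) 0 = poly2 (partial2 2 p) r"
    "2 * coeff (coeff (translate2 r p) 0) 2 = poly2 (partial2 1 (partial2 1 p)) r"
    "coeff (coeff (translate2 r p) 1) 1 = poly2 (partial2 1 (partial2 2 p)) r"
    "2 * coeff (coeff (translate2 r p) 2) 0 = poly2 (partial2 2 (partial2 2 p)) r"
    by (simp_all add: at_r flip: partial2_translate2)
      (simp_all add: partial2_def coeff_map_poly coeff_pderiv numeral_2_eq_2 numeral_poly algebra_simps)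
qed

section \<open>Homogeneous parts and complexification\<close>

lemma hom_part_eq_0_iff:
  "hom_part n p = 0 \<longleftrightarrow> (\<forall>j\<le>n. coeff (coeff p j) (n - j) = 0)"
proof
  assume "hom_part n p = 0"
  \<comment> \<open>The summands carry distinct powers of x2, so they cannot cancel.\<close>
  moreover have "coeff (hom_part n p) j = monom (coeff (coeff p j) (n - j)) (n - j)" if "j \<le> n" for j
    using that by (simp add: hom_part_def coeff_sum)
  ultimately show "\<forall>j\<le>n. coeff (coeff p j) (n - j) = 0"
    by (metis coeff_0 monom_eq_0_iff)
qed (simp add: hom_part_def)

lemma complexify_add: "complexify (p + q) = complexify p + complexify q"
  by (simp add: complexify_def poly_eq_iff coeff_map_poly)

lemma complexify_monom: "complexify (monom (monom c i) j) = monom (monom (complex_of_real c) i) j"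
  by (simp add: complexify_def map_poly_monom)

lemma partial2_complexify: "partial2 i (complexify p) = complexify (partial2 i p)"
  by (simp add: complexify_def partial2_def poly_eq_iff coeff_map_poly coeff_pderiv of_nat_poly)

lemma poly2_complexify:
  "poly2 (complexify p) (\<chi> i. complex_of_real (x$i)) = complex_of_real (poly2 p x)"
proof -
  have inner: "poly (map_poly complex_of_real q) (of_real a) = of_real (poly q a)" for q a
    by (induction q) (simp_all add: map_poly_pCons)
  have "poly (poly (complexify p) [:of_real b:]) (of_real a) = of_real (poly (poly p [:b:]) a)" for a b
    by (induction p) (simp_all add: complexify_def map_poly_pCons inner)
  then show ?thesis
    by (simp add: poly2_def)
qed

text \<open>The first three hypotheses kill the homogeneous parts of degrees 0 and 1, and the last
  keeps the part of degree 2; so the lowest form is the quadratic one.\<close>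

lemma lowest_form_double_point:
  fixes q :: "real poly2"
  assumes "coeff (coeff q 0) 0 = 0" "coeff (coeff q 0) 1 = 0" "coeff (coeff q 1) 0 = 0"
    and "coeff (coeff q 0) 2 \<noteq> 0 \<or> coeff (coeff q 1) 1 \<noteq> 0 \<or> coeff (coeff q 2) 0 \<noteq> 0"
  shows "poly2 (complexify (lowest_form q)) v =
    of_real (coeff (coeff q 0) 2) * (v$1)^2 + of_real (coeff (coeff q 1) 1) * v$1 * v$2
      + of_real (coeff (coeff q 2) 0) * (v$2)^2"
proof -
  have "(LEAST n. hom_part n q \<noteq> 0) = 2"
  proof (rule Least_equality)
    show "hom_part 2 q \<noteq> 0"
      using assms(4) by (auto simp: hom_part_eq_0_iff numeral_2_eq_2 le_Suc_eq)
    show "2 \<le> n" if "hom_part n q \<noteq> 0" for n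
    proof (rule ccontr)
      assume "\<not> 2 \<le> n"
      then have "n = 0 \<or> n = 1"
        by auto
      with that assms(1-3) show False
        by (auto simp: hom_part_eq_0_iff le_Suc_eq)
    qed
  qed
  then show ?thesis
    by (simp add: lowest_form_def hom_part_def numeral_2_eq_2 complexify_add complexify_monom)
      (simp add: poly2_def poly_monom power2_eq_square algebra_simps)
qed

section \<open>The Newton polynomial, gamma, and eigenvectors of a rotated symmetric matrix\<close>

lemma newton_poly_alt:
  "newton_poly f r = f$1 * const2 (poly2 (f$2) r) - const2 (poly2 (f$1) r) * f$2"
  by (simp add: newton_poly_def columns2_def det_2 transpose_def algebra_simps)

lemma gamma_alt: "gamma f $ i = partial2 i (f$1) * f$2 - f$1 * partial2 i (f$2)"
  by (simp add: gamma_def columns2_def det_2 transpose_def algebra_simps)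

text \<open>Here A = P H for the symmetric H with rows (a, b) and (b, c), and the form is det
  [v, A v]; its nonzero zeros are therefore the eigenvectors of A.\<close>

lemma union_eigenspaces_rotated_symmetric:
  fixes A :: "complex^2^2"
  assumes A: "A$1$1 = - b" "A$1$2 = - c" "A$2$1 = a" "A$2$2 = b"
  shows "(\<Union>l \<in> {l. is_eigenvalue A l}. eigenspace A l) =
    {v. a * (v$1)^2 + 2 * b * v$1 * v$2 + c * (v$2)^2 = 0}" (is "?L = ?R")
proof -
  have eig: "A *v v = l *s v \<longleftrightarrow> - b * v$1 - c * v$2 = l * v$1 \<and> a * v$1 + b * v$2 = l * v$2" for v l
    by (simp add: vec_eq_iff forall_2 matrix_vector_mult_def sum_2 A)
  have nz: "v \<noteq> 0 \<longleftrightarrow> v$1 \<noteq> 0 \<or> v$2 \<noteq> 0" for v :: "complex^2"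
    by (simp add: vec_eq_iff forall_2)
  have isotropic: "\<exists>l. A *v v = l *s v" if v: "v \<noteq> 0" "v \<in> ?R" for v
  proof (cases "v$1 = 0")
    case True
    with v have "c = 0"
      by (simp add: nz)
    with True show ?thesis
      by (auto simp: eig)
  next
    case False
    have "(a * v$1 + b * v$2) * v$1 = (- b * v$1 - c * v$2) * v$2"
      using v(2) by (simp add: power2_eq_square) algebra
    \<comment> \<open>The eigenvalue is forced by the first coordinate of A v = l v; the vanishing
      of the form makes the second coordinate agree.\<close>
    then show ?thesis
      using False by (intro exI[of _ "(- b * v$1 - c * v$2) / v$1"]) (simp add: eig field_simps)
  qed
  \<comment> \<open>A union over an empty set of eigenvalues would miss v = 0, so an eigenvalue must
    be exhibited. A binary quadratic form over the complex numbers has a nonzero zero, which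
    supplies one.\<close>
  have "\<exists>v. v \<noteq> 0 \<and> v \<in> ?R"
  proof (cases "a = 0")
    case True
    then show ?thesis
      by (intro exI[of _ "vector [1, 0]"]) (simp add: nz)
  next
    case False
    \<comment> \<open>The quadratic formula: t = (s - b) / a is a root of a t^2 + 2 b t + c, and the
      witness is (t, 1) scaled by a.\<close>
    define s where "s = csqrt (b^2 - a * c)"
    have s: "s^2 = b^2 - a * c"
      by (simp add: s_def)
    have "a * (s - b)^2 + 2 * b * (s - b) * a + c * a^2 = 0"
      using s by algebra
    then show ?thesis
      using False by (intro exI[of _ "vector [s - b, a]"]) (simp add: nz)
  qed
  then obtain l where l: "is_eigenvalue A l"
    using isotropic unfolding is_eigenvalue_def by blast
  show ?thesis
  proof (intro subset_antisym subsetI)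
    fix v assume "v \<in> ?L"
    then obtain l where "- b * v$1 - c * v$2 = l * v$1" "a * v$1 + b * v$2 = l * v$2"
      by (auto simp: eigenspace_def eig)
    then have "a * (v$1)^2 + 2 * b * v$1 * v$2 + c * (v$2)^2 = 0"
      by algebra
    then show "v \<in> ?R"
      by simp
  next
    fix v assume v: "v \<in> ?R"
    show "v \<in> ?L"
    proof (cases "v = 0")
      case True
      with l show ?thesis
        by (auto simp: eigenspace_def)
    next
      case False
      with isotropic[OF _ v] obtain l where "A *v v = l *s v"
        by blast
      with False show ?thesis
        by (auto simp: eigenspace_def is_eigenvalue_def)
    qed
  qed
qed

theorem theorem39:
  fixes f :: "(real poly2)^2" and r :: "real^2"
  assumes "total_degree (f$1) > 0" and "total_degree (f$2) > 0"
    and "total_degree (f$1) \<ge> total_degree (f$2)" and "total_degree (f$1) \<ge> 2"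
    and "generic f"
    and "r \<in> singular_base_points f"
  shows "newton_tangent_cone f r =
    (let A = complex_mat (poly2_mat (jacobian2 (rot_P *v gamma f)) r)
     in \<Union>c \<in> {c. is_eigenvalue A c}. eigenspace A c)"
proof -
  define h where "h = newton_poly f r"
  \<comment> \<open>In h the base point is frozen, so H is the Hessian in x alone; gamma, by
    contrast, lets both columns of the determinant vary.\<close>
  define H where "H i j = poly2 (partial2 i (partial2 j h)) r" for i j
  have h_r: "poly2 h r = 0"
    by (simp add: h_def newton_poly_alt)
  have f_r: "poly2 (f$1) r \<noteq> 0 \<or> poly2 (f$2) r \<noteq> 0"
    using assms(6) by (simp add: singular_base_points_def poly2_vec_def vec_eq_iff forall_2)
  have grad: "poly2 (partial2 i h) r = 0" for i
    using assms(6)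
    by (simp add: singular_base_points_def newton_singularities_def poly2_vec_def gradient2_def
        vec_eq_iff h_def)
  have H_sym: "H 2 1 = H 1 2"
    by (simp add: H_def partial2_commute)

  \<comment> \<open>Genericity speaks of the complex curves, so the real singular point is carried
    over to a complex one with the same derivatives.\<close>
  define fc where "fc = (\<chi> j. complexify (f$j))"
  define rc where "rc = (\<chi> i. complex_of_real (r$i))"
  have fc_r: "poly2 (fc$i) rc = of_real (poly2 (f$i) r)"
    "poly2 (partial2 j (fc$i)) rc = of_real (poly2 (partial2 j (f$i)) r)"
    "poly2 (partial2 j (partial2 k (fc$i))) rc = of_real (poly2 (partial2 j (partial2 k (f$i))) r)"
    for i j k
    by (simp_all add: fc_def rc_def partial2_complexify poly2_complexify)
  have grad_c: "poly2 (partial2 i (newton_poly fc rc)) rc = of_real (poly2 (partial2 i h) r)" for i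
    by (simp add: newton_poly_alt h_def fc_r)
  have hess_c: "poly2 (partial2 i (partial2 j (newton_poly fc rc))) rc = of_real (H i j)" for i j
    by (simp add: newton_poly_alt h_def H_def fc_r)
  have "poly2_vec fc rc \<noteq> 0"
    using f_r by (simp add: poly2_vec_def vec_eq_iff forall_2 fc_r)
  \<comment> \<open>The parameter t = 1 puts the base point on its own curve.\<close>
  moreover have "rc \<in> newton_singularities fc rc"
    by (auto simp: newton_singularities_def newton_curve_def poly2_vec_def gradient2_def vec_eq_iff
        grad_c grad intro: exI[of _ 1])
  ultimately have "det (poly2_mat (hessian2 (newton_poly fc rc)) rc) \<noteq> 0"
    using assms(5) by (auto simp: generic_def Let_def generic_newton_curves_def fc_def)
  \<comment> \<open>By symmetry these are all the entries of the Hessian, and its determinant would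
    vanish with them.\<close>
  then have H_nz: "H 1 1 \<noteq> 0 \<or> H 1 2 \<noteq> 0 \<or> H 2 2 \<noteq> 0"
    by (auto simp: det_2 poly2_mat_def poly2_vec_def hessian2_def jacobian2_def gradient2_def hess_c
        partial2_commute[of 2 1])

  have cone: "newton_tangent_cone f r =
    {v. of_real (H 1 1) * (v$1)^2 + 2 * of_real (H 1 2) * v$1 * v$2 + of_real (H 2 2) * (v$2)^2 = 0}"
  proof -
    note tc = taylor_coeffs[of r h]
    have coeffs: "coeff (coeff (translate2 r h) 0) 2 = H 1 1 / 2"
      "coeff (coeff (translate2 r h) 1) 1 = H 1 2"
      "coeff (coeff (translate2 r h) 2) 0 = H 2 2 / 2"
      using tc(4-6) by (simp_all add: H_def)
    have "poly2 (complexify (lowest_form (translate2 r h))) v =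
      of_real (H 1 1 / 2) * (v$1)^2 + of_real (H 1 2) * v$1 * v$2 + of_real (H 2 2 / 2) * (v$2)^2" for v
      using lowest_form_double_point[of "translate2 r h" v] H_nz tc(1-3) h_r grad
      by (simp add: coeffs[unfolded One_nat_def])
    \<comment> \<open>Doubling clears the Taylor factor 1/2 and does not change the zero
      set.\<close>
    then have "2 * poly2 (complexify (lowest_form (translate2 r h))) v =
      of_real (H 1 1) * (v$1)^2 + 2 * of_real (H 1 2) * v$1 * v$2 + of_real (H 2 2) * (v$2)^2" for v
      by (simp add: algebra_simps)
    then show ?thesis
      unfolding newton_tangent_cone_def zeros2_def h_def[symmetric]
      by (metis (no_types, lifting) mult_eq_0_iff zero_neq_numeral)
  qed

  \<comment> \<open>For i \<noteq> j this is the vanishing of the Jacobian determinant of f at r: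
    both of its columns satisfy the linear relation given by \<open>grad\<close>, whose coefficients
    f2(r) and -f1(r) are not both 0.\<close>
  have jac_f: "poly2 (partial2 i (f$1)) r * poly2 (partial2 j (f$2)) r =
    poly2 (partial2 j (f$1)) r * poly2 (partial2 i (f$2)) r" for i j
  proof -
    have "poly2 (partial2 k (f$1)) r * poly2 (f$2) r = poly2 (f$1) r * poly2 (partial2 k (f$2)) r" for k
      using grad[of k] by (simp add: h_def newton_poly_alt)
    from this[of i] this[of j] f_r show ?thesis
      by algebra
  qed
  \<comment> \<open>Besides the second derivatives, the product rule yields a difference of products
    of first derivatives, which \<open>jac_f\<close> cancels.\<close>
  have jac: "poly2 (partial2 j (gamma f $ i)) r = H j i" for i j
  proof -
    have "H j i = poly2 (partial2 j (partial2 i (f$1))) r * poly2 (f$2) r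
        - poly2 (f$1) r * poly2 (partial2 j (partial2 i (f$2))) r"
      by (simp add: H_def h_def newton_poly_alt)
    with jac_f[of i j] show ?thesis
      by (simp add: gamma_alt partial2_mult algebra_simps)
  qed
  have rot: "(rot_P *v gamma f)$1 = - (gamma f $ 2)" "(rot_P *v gamma f)$2 = gamma f $ 1"
    by (simp_all add: rot_P_def matrix_vector_mult_def sum_2)
  define A where "A = complex_mat (poly2_mat (jacobian2 (rot_P *v gamma f)) r)"
  \<comment> \<open>These entries match the eigenspace lemma with a = H 1 1, b = H 1 2 and c = H 2
    2, the coefficients found in \<open>cone\<close>.\<close>
  have "A$1$1 = - of_real (H 1 2)" "A$1$2 = - of_real (H 2 2)"
    "A$2$1 = of_real (H 1 1)" "A$2$2 = of_real (H 1 2)"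
    by (simp_all add: A_def complex_mat_def poly2_mat_def poly2_vec_def jacobian2_def gradient2_def
        rot jac H_sym)
  from union_eigenspaces_rotated_symmetric[OF this] cone show ?thesis
    by (simp add: A_def Let_def)
qed

end
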